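(* Let $\phi:\mathbb{R}^n\to\mathbb{R}$ be continuously differentiable with $L$-Lipschitz gradient and strongly convex, i.e. for some $\mu>0$, $\phi(x)\ge\phi(y)+\nabla\phi(y)^T(x-y)+\frac\mu2\|x-y\|^2$ for all $x,y\in\mathbb{R}^n$; let $x^\star$ be its minimizer and $\phi^\star=\phi(x^\star)$. Let $|f(x,\xi)-\phi(x)|\le\epsilon_f$ for all $x\in\mathbb{R}^n$ and all realizations of $\xi$. Run the modified line search algorithm of the context with $d_k=-g_k$. Suppose the random gradients $\{G_k\}$ are $(1-\delta)$-probabilistically sufficiently accurate with constant $\theta\in[0,\frac{1-c_1}{2-c_1})$ (see context), with $\delta<\frac12-\frac{\sqrt\gamma}{2}$ for some $\gamma\in(0,1)$. Suppose, with this same $\gamma$, that $\epsilon>0$ satisfies $$\epsilon>\frac{4\epsilon_f}{\left(1-\frac{2\mu c_1(1-\theta)(1-2\theta-c_1(1-\theta))}{L}\right)^{-\gamma}-1}.$$ Then the expected number of iterations $N_\epsilon$ that the algorithm takes until $\phi(X_k)-\phi^\star\le\epsilon$ occurs (for the first time) satisfies $$\mathbb{E}[N_\epsilon]\le\frac{2(1-\delta)}{(1-2\delta)^2-\gamma}\left[2\log_{1/M}\left(\frac{\phi(x_0)-\phi^\star}{\epsilon}\right)+(1-\gamma)\log_\tau\left(\frac{\bar\alpha}{\alpha_0}\right)\right],$$ where $M=1-\frac{2\mu c_1(1-\theta)(1-2\theta-c_1(1-\theta))}{L}$ and $\bar\alpha=\frac{2(1-2\theta-c_1(1-\theta))}{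L(1-\theta)}$.
   Context: **Algorithm.** Inputs: $x_0\in\mathbb{R}^n$, $\alpha_0>0$, $\tau\in(0,1]$, $c_1\in(0,1)$, noise bound $\epsilon_f\ge0$. At iteration $k=0,1,2,\dots$: construct a (random) gradient estimate $g_k$ of $\nabla\phi(x_k)$ and set $d_k=-g_k$; check $$f(x_k+\alpha_kd_k,\xi)\le f(x_k,\xi)+c_1\alpha_kd_k^Tg_k+2\epsilon_f$$ (the realizations of $\xi$ in the two evaluations may be different, dependent, independent or identical). If it holds, iteration $k$ is successful: $x_{k+1}=x_k+\alpha_kd_k$, $\alpha_{k+1}=\tau^{-1}\alpha_k$. Otherwise it is unsuccessful: $x_{k+1}=x_k$, $\alpha_{k+1}=\tau\alpha_k$. Random versions of $g_k,x_k,\alpha_k$ are denoted $G_k,X_k,\mathcal{A}_k$. $\mathcal{E}_{k-1}$ is all function-noise history up to iteration $k-1$, and $\mathcal{F}_{k-1}^{G,\mathcal{E}}=\sigma(G_0,\dots,G_{k-1},\mathcal{E}_{k-1})$; $X_k$ and $\mathcal{A}_k$ are determined by $\mathcal{F}_{k-1}^{G,\mathcal{E}}$. **Sufficiently accurate gradients.** $\{G_k\}$ is $(1-\delta)$-probabilistically sufficiently accurate with constant $\theta\in[0,\frac{1-c_1}{2-c_1})$ if the indicators $I_k=\mathbf{1}\{\|G_k-\nabla\phi(X_k)\|\le\theta\|\nabla\phi(X_k)\|\}$ satisfy $\mathbb{P}(I_k=1\mid\mathcal{F}_{k-1}^{G,\mathcal{E}})\ge1-\delta$ for all $k$ and all realizations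 of $\mathcal{F}_{k-1}^{G,\mathcal{E}}$. Norms are Euclidean. **Step size convention.** It is assumed, without loss of generality, that $\bar\alpha=\tau^c\alpha_0$ for some positive integer $c$. If $\tau=1$ the step size is constant and must start at a value $\alpha_0\le\bar\alpha$; for $\tau=1$ and $\alpha_0=\bar\alpha$ the term with $\log_\tau$ is read as zero.
   Formalization: For τ=1 with φ(x0)−φ*>ε, the claimed bound is additionally assumed to be at least 2 (the claim fails for small bounds, as at least one iteration is needed); a negative right-hand side, possible only when φ(x0)−φ*<ε and N_ε=0, is read as 0. *)

theory Defs
  imports "HOL-Probability.Probability"
begin

text \<open>
  One realization of the line search: \<open>g k\<close> is the gradient estimate, and \<open>s k\<close>, \<open>s' k\<close> are the
  realizations of \<open>\<xi>\<close> used to evaluate \<open>f\<close> at the iterate and at the trial point. They are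
  unrelated parameters, so they may coincide or depend on each other.
\<close>

definition sufficient_decrease ::
  "('v::real_inner \<Rightarrow> 's \<Rightarrow> real) \<Rightarrow> real \<Rightarrow> real \<Rightarrow> 'v \<Rightarrow> real \<Rightarrow> 'v \<Rightarrow> 'v \<Rightarrow> 's \<Rightarrow> 's \<Rightarrow> bool"
where
  "sufficient_decrease f c1 \<epsilon>f x \<alpha> g d s s' \<longleftrightarrow>
     f (x + \<alpha> *\<^sub>R d) s' \<le> f x s + c1 * \<alpha> * (d \<bullet> g) + 2 * \<epsilon>f"

definition line_search_run ::
  "('v::real_inner \<Rightarrow> 's \<Rightarrow> real) \<Rightarrow> real \<Rightarrow> real \<Rightarrow> real \<Rightarrow> 'v \<Rightarrow> real \<Rightarrow>
   (nat \<Rightarrow> 'v) \<Rightarrow> (nat \<Rightarrow> 's) \<Rightarrow> (nat \<Rightarrow> 's) \<Rightarrow> (nat \<Rightarrow> 'v) \<Rightarrow> (nat \<Rightarrow> real) \<Rightarrow> bool"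
where
  "line_search_run f \<tau> c1 \<epsilon>f x0 \<alpha>0 g s s' x \<alpha> \<longleftrightarrow>
     x 0 = x0 \<and> \<alpha> 0 = \<alpha>0 \<and>
     (\<forall>k. let d = - g k in
        if sufficient_decrease f c1 \<epsilon>f (x k) (\<alpha> k) (g k) d (s k) (s' k)
        then x (Suc k) = x k + \<alpha> k *\<^sub>R d \<and> \<alpha> (Suc k) = inverse \<tau> * \<alpha> k
        else x (Suc k) = x k \<and> \<alpha> (Suc k) = \<tau> * \<alpha> k)"

definition function_noise ::
  "('v \<Rightarrow> real) \<Rightarrow> ('v \<Rightarrow> 's \<Rightarrow> real) \<Rightarrow> (nat \<Rightarrow> 'w \<Rightarrow> 'v) \<Rightarrow> (nat \<Rightarrow> 'w \<Rightarrow> 's) \<Rightarrow> nat \<Rightarrow> 'w \<Rightarrow> real"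
where
  "function_noise \<phi> f Y \<xi> k \<omega> = f (Y k \<omega>) (\<xi> k \<omega>) - \<phi> (Y k \<omega>)"

text \<open>
  \<open>history P G E E' k\<close> is the \<open>\<sigma>\<close>-algebra of everything observed strictly before iteration \<open>k\<close>
  (index \<open>k - 1\<close> in the usual notation): the gradient estimates and both noise values of
  iterations \<open>j < k\<close>. For \<open>k = 0\<close> it is the trivial \<open>\<sigma>\<close>-algebra on \<open>space P\<close>.
\<close>

definition history ::
  "'w measure \<Rightarrow> (nat \<Rightarrow> 'w \<Rightarrow> 'v::topological_space) \<Rightarrow> (nat \<Rightarrow> 'w \<Rightarrow> real) \<Rightarrow> (nat \<Rightarrow> 'w \<Rightarrow> real)
   \<Rightarrow> nat \<Rightarrow> 'w measure"
where
  "history P G E E' k = sigma (space P)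
     ({G j -` B \<inter> space P | j B. j < k \<and> B \<in> sets borel} \<union>
      {E j -` B \<inter> space P | j B. j < k \<and> B \<in> sets borel} \<union>
      {E' j -` B \<inter> space P | j B. j < k \<and> B \<in> sets borel})"

definition prob_sufficiently_accurate ::
  "'w measure \<Rightarrow> (nat \<Rightarrow> 'w measure) \<Rightarrow> (nat \<Rightarrow> 'w \<Rightarrow> 'v::real_normed_vector) \<Rightarrow> (nat \<Rightarrow> 'w \<Rightarrow> 'v)
   \<Rightarrow> ('v \<Rightarrow> 'v) \<Rightarrow> real \<Rightarrow> real \<Rightarrow> bool"
where
  "prob_sufficiently_accurate P F G X grad\<phi> \<theta> \<delta> \<longleftrightarrow>
     (\<forall>k. AE \<omega> in P. 1 - \<delta> \<le>
        real_cond_exp P (F k)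
          (indicator {\<omega> \<in> space P. norm (G k \<omega> - grad\<phi> (X k \<omega>)) \<le> \<theta> * norm (grad\<phi> (X k \<omega>))}) \<omega>)"

text \<open>Infinite if the accuracy \<open>\<epsilon>\<close> is never reached.\<close>

definition stopping_index ::
  "('v \<Rightarrow> real) \<Rightarrow> real \<Rightarrow> real \<Rightarrow> (nat \<Rightarrow> 'w \<Rightarrow> 'v) \<Rightarrow> 'w \<Rightarrow> enat"
where
  "stopping_index \<phi> \<phi>star \<epsilon> X \<omega> = (INF k \<in> {k. \<phi> (X k \<omega>) - \<phi>star \<le> \<epsilon>}. enat k)"

end

theory Submission
  imports Defs
begin

text \<open>
  Put \<open>Z = log\<^bsub>1/M\<^esub> ((\<phi> x - \<phi> xstar) / \<epsilon>)\<close> and write the step size as \<open>\<alpha>bar * \<tau> powi (- m)\<close> with an integer \<open>m\<close>.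
  Before the accuracy is reached, a successful iteration raises \<open>Z\<close> by at most \<open>\<gamma>\<close>, a successful
  iteration with an accurate gradient and \<open>m \<ge> 0\<close> lowers it by at least \<open>1 - \<gamma>\<close>, an unsuccessful
  one keeps it, and an accurate gradient with \<open>m \<le> 0\<close> forces success. Hence the potential
  \<open>Z + (\<bar>m\<bar> - \<gamma> m) / 2\<close> grows by at most \<open>(1 + \<gamma>) / 2\<close> in every iteration, and by at most
  \<open>(1 + \<gamma>) / 2 - 1\<close> if the gradient is accurate. This bounds the number of accurate iterations
  among the first \<open>n\<close> along every path; as it is on average at least \<open>(1 - \<delta>) n\<close>, taking
  expectations bounds the expected stopping time. The resulting drift \<open>(1 - 2\<delta> - \<gamma>) / 2\<close> is at
  least twice the drift \<open>((1 - 2\<delta>)\<^sup>2 - \<gamma>) / (4 (1 - \<delta>))\<close> of the claim, which pays for the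
  overshoot of the last iteration. If \<open>\<tau> = 1\<close>, the potential is \<open>Z\<close> alone.
\<close>

section \<open>Quadratic bounds from smoothness and strong convexity\<close>

text \<open>Along the ray, \<open>h\<close> is \<open>\<phi>\<close> minus the linear and quadratic
  terms of the bound. By Cauchy-Schwarz and the Lipschitz condition its derivative is nonpositive
  for \<open>t \<ge> 0\<close>, and the claim is \<open>h 1 \<le> h 0\<close>.\<close>

lemma descent_lemma:
  fixes \<phi> :: "'v::real_inner \<Rightarrow> real"
  assumes gradient: "\<And>x. GDERIV \<phi> x :> g x"
    and Lipschitz: "L-lipschitz_on UNIV g"
  shows "\<phi> (x + d) \<le> \<phi> x + g x \<bullet> d + L / 2 * (norm d)\<^sup>2"
proof -
  define h where "h t = \<phi> (x + t *\<^sub>R d) - t * (g x \<bullet> d) - L / 2 * t\<^sup>2 * (norm d)\<^sup>2" for t :: real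
  have nonpos: "\<exists>y. DERIV h t :> y \<and> y \<le> 0" if t: "0 \<le> t" for t
  proof (intro exI conjI)
    have "((\<lambda>t. \<phi> (x + t *\<^sub>R d)) has_derivative (\<lambda>s. (s *\<^sub>R d) \<bullet> g (x + t *\<^sub>R d))) (at t)"
    proof (rule has_derivative_compose[where g = \<phi> and g' = "\<lambda>v. v \<bullet> g (x + t *\<^sub>R d)"])
      show "((\<lambda>t. x + t *\<^sub>R d) has_derivative (\<lambda>s. s *\<^sub>R d)) (at t)"
        by (auto intro!: derivative_eq_intros)
      show "(\<phi> has_derivative (\<lambda>v. v \<bullet> g (x + t *\<^sub>R d))) (at (x + t *\<^sub>R d))"
        using gradient unfolding gderiv_def .
    qed
    then have "DERIV (\<lambda>t. \<phi> (x + t *\<^sub>R d)) t :> g (x + t *\<^sub>R d) \<bullet> d"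
      unfolding has_field_derivative_def
      by (rule has_derivative_eq_rhs) (simp add: fun_eq_iff inner_commute)
    moreover have "DERIV (\<lambda>t. t * (g x \<bullet> d)) t :> g x \<bullet> d"
      and "DERIV (\<lambda>t. L / 2 * t\<^sup>2 * (norm d)\<^sup>2) t :> L * t * (norm d)\<^sup>2"
      by (auto intro!: derivative_eq_intros)
    ultimately show "DERIV h t :> g (x + t *\<^sub>R d) \<bullet> d - g x \<bullet> d - L * t * (norm d)\<^sup>2"
      unfolding h_def by (intro DERIV_diff)
    have "(g (x + t *\<^sub>R d) - g x) \<bullet> d \<le> norm (g (x + t *\<^sub>R d) - g x) * norm d"
      by (rule norm_cauchy_schwarz)
    also have "\<dots> \<le> (L * (t * norm d)) * norm d"
      using lipschitz_onD[OF Lipschitz, of "x + t *\<^sub>R d" x] t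
      by (intro mult_right_mono) (auto simp: dist_norm)
    finally show "g (x + t *\<^sub>R d) \<bullet> d - g x \<bullet> d - L * t * (norm d)\<^sup>2 \<le> 0"
      by (simp add: inner_diff_left power2_eq_square mult_ac)
  qed
  have "h 1 \<le> h 0"
    by (rule DERIV_nonpos_imp_nonincreasing[OF zero_le_one]) (rule nonpos)
  then show ?thesis by (simp add: h_def)
qed

text \<open>Completing the square in \<open>v\<close>. It is applied with
  \<open>a = \<phi> x\<close>, \<open>b = \<phi> xstar\<close> and \<open>v = xstar - x\<close>, so
  that the squared gradient norm dominates the optimality gap.\<close>

lemma Polyak_Lojasiewicz:
  fixes g :: "'v::real_inner"
  assumes "0 < \<mu>" and "b \<ge> a + g \<bullet> v + \<mu> / 2 * (norm v)\<^sup>2"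
  shows "2 * \<mu> * (a - b) \<le> (norm g)\<^sup>2"
proof -
  have "0 \<le> (norm (g + \<mu> *\<^sub>R v))\<^sup>2" by simp
  also have "\<dots> = (norm g)\<^sup>2 + 2 * \<mu> * (g \<bullet> v + \<mu> / 2 * (norm v)\<^sup>2)"
    unfolding power2_norm_eq_inner
    by (simp add: inner_add_left inner_add_right inner_commute algebra_simps)
  also have "\<dots> \<le> (norm g)\<^sup>2 + 2 * \<mu> * (b - a)"
    using assms by (intro add_left_mono mult_left_mono) auto
  finally show ?thesis by (simp add: algebra_simps)
qed

section \<open>Conditional probabilities and expected stopping times\<close>

text \<open>The conditional bound is integrated over \<open>D\<close>; since \<open>D\<close> lies
  in \<open>F\<close>, the conditional expectation may there be replaced by the indicator of
  \<open>A\<close>.\<close>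

lemma (in prob_space) cond_exp_indicator_ge:
  assumes sub: "subalgebra M F" and A: "A \<in> sets M" and D: "D \<in> sets F"
    and ge: "AE \<omega> in M. p \<le> real_cond_exp M F (indicator A) \<omega>"
  shows "p * prob D \<le> prob (A \<inter> D)"
proof -
  interpret finite_measure_subalgebra M F
    by unfold_locales (rule sub)
  have DM: "D \<in> sets M" using D sub by (auto simp: subalgebra_def)
  have int: "integrable M (indicator A :: _ \<Rightarrow> real)" using A by (auto simp: emeasure_eq_measure)
  have "p * prob D = (\<integral>\<omega>. indicator D \<omega> * p \<partial>M)"
    using DM by (simp add: mult.commute)
  also have "\<dots> \<le> (\<integral>\<omega>. indicator D \<omega> * real_cond_exp M F (indicator A) \<omega> \<partial>M)"
  proof (rule integral_mono_AE)
    show "integrable M (\<lambda>\<omega>. indicator D \<omega> * real_cond_exp M F (indicator A) \<omega>)"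
      using integrable_mult_indicator[OF DM real_cond_exp_int(1)[OF int]] by simp
    show "AE \<omega> in M. indicator D \<omega> * p \<le> indicator D \<omega> * real_cond_exp M F (indicator A) \<omega>"
      using ge by eventually_elim (auto simp: indicator_def)
  qed (use DM in \<open>auto simp: emeasure_eq_measure\<close>)
  also have "\<dots> = (\<integral>\<omega>. indicator D \<omega> * indicator A \<omega> \<partial>M)"
    using real_cond_exp_intA[OF int D] by (simp add: set_lebesgue_integral_def)
  also have "\<dots> = prob (A \<inter> D)"
    using A DM by (simp add: indicator_inter_arith[symmetric] Int_commute)
  finally show ?thesis .
qed

text \<open>Let \<open>S\<close> be the expected value of \<open>N\<close> truncated at
  \<open>n\<close>. Conditioning gives at least \<open>p * S\<close> expected events
  \<open>T i\<close> before stopping, while \<open>count\<close> allows at most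
  \<open>K + \<kappa> * S\<close>. As \<open>S\<close> is finite,
  \<open>S \<le> K / (p - \<kappa>)\<close> follows uniformly in \<open>n\<close>, and the tail-sum
  formula passes to the limit.\<close>

lemma (in prob_space) expected_stopping_time_le:
  fixes N :: "'a \<Rightarrow> enat" and T :: "nat \<Rightarrow> 'a set"
  assumes sub: "\<And>k. subalgebra M (F k)"
    and N: "\<And>k. {\<omega> \<in> space M. enat k < N \<omega>} \<in> sets (F k)"
    and T: "\<And>k. T k \<in> sets M"
    and cond: "\<And>k. AE \<omega> in M. p \<le> real_cond_exp M (F k) (indicator (T k)) \<omega>"
    and count: "\<And>n \<omega>. \<omega> \<in> space M \<Longrightarrow> enat n \<le> N \<omega> \<Longrightarrow>
      (\<Sum>i<n. indicator (T i) \<omega>) \<le> K + \<kappa> * real n"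
    and less: "\<kappa> < p"
  shows "(\<integral>\<^sup>+\<omega>. ennreal_of_enat (N \<omega>) \<partial>M) \<le> ennreal (K / (p - \<kappa>))"
proof -
  define D where "D k = {\<omega> \<in> space M. enat k < N \<omega>}" for k
  have D: "D k \<in> sets M" for k
    using N[of k] sub[of k] by (auto simp: subalgebra_def D_def)
  have path: "(\<Sum>i<n. indicator (T i \<inter> D i) \<omega>) \<le> K + \<kappa> * (\<Sum>i<n. indicator (D i) \<omega>)"
    if \<omega>: "\<omega> \<in> space M" for n \<omega>
  proof -
    \<comment> \<open>The witness is the minimum of \<open>n\<close> and \<open>N \<omega>\<close>:
      the sums over \<open>D i\<close> stop there, and \<open>count\<close> is available up to
      there.\<close>
    have "\<exists>m. enat m \<le> N \<omega> \<and> (\<forall>i. i < m \<longleftrightarrow> i < n \<and> enat i < N \<omega>)"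
    proof (cases "N \<omega>")
      case (enat l)
      then show ?thesis by (intro exI[of _ "min n l"]) auto
    next
      case infinity
      then show ?thesis by (intro exI[of _ n]) auto
    qed
    then obtain m where m: "enat m \<le> N \<omega>" "\<And>i. i < m \<longleftrightarrow> i < n \<and> enat i < N \<omega>"
      by blast
    have eq: "{..<m} = {i \<in> {..<n}. enat i < N \<omega>}"
      by (simp only: set_eq_iff lessThan_iff mem_Collect_eq m(2)) simp
    have "(\<Sum>i<n. indicator (T i \<inter> D i) \<omega>) = (\<Sum>i<m. indicator (T i) \<omega> :: real)"
      unfolding eq sum.inter_filter[OF finite_lessThan]
      by (rule sum.cong) (use \<omega> in \<open>simp_all add: D_def indicator_def\<close>)
    moreover have "(\<Sum>i<n. indicator (D i) \<omega>) = (\<Sum>i<m. 1 :: real)"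
      unfolding eq sum.inter_filter[OF finite_lessThan]
      by (rule sum.cong) (use \<omega> in \<open>simp_all add: D_def indicator_def\<close>)
    ultimately show ?thesis using count[OF \<omega> m(1)] by simp
  qed
  have bound: "(\<Sum>i<n. prob (D i)) \<le> K / (p - \<kappa>)" for n
  proof -
    have TD: "T i \<inter> D i \<in> sets M" for i using T D by auto
    have "p * (\<Sum>i<n. prob (D i)) \<le> (\<Sum>i<n. prob (T i \<inter> D i))"
      unfolding sum_distrib_left
      by (intro sum_mono cond_exp_indicator_ge[OF sub T _ cond]) (use N in \<open>simp add: D_def\<close>)
    also have "\<dots> = (\<integral>\<omega>. (\<Sum>i<n. indicator (T i \<inter> D i) \<omega>) \<partial>M)"
      using TD by (subst Bochner_Integration.integral_sum) (auto simp: emeasure_eq_measure)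
    also have "\<dots> \<le> (\<integral>\<omega>. K + \<kappa> * (\<Sum>i<n. indicator (D i) \<omega>) \<partial>M)"
    proof (rule integral_mono)
      show "integrable M (\<lambda>\<omega>. \<Sum>i<n. indicator (T i \<inter> D i) \<omega> :: real)"
        using TD by (intro Bochner_Integration.integrable_sum) (auto simp: emeasure_eq_measure)
      show "integrable M (\<lambda>\<omega>. K + \<kappa> * (\<Sum>i<n. indicator (D i) \<omega>))"
        using D by (intro Bochner_Integration.integrable_add Bochner_Integration.integrable_sum
            integrable_mult_right) (auto simp: emeasure_eq_measure)
    qed (use path in auto)
    also have "\<dots> = K + \<kappa> * (\<Sum>i<n. prob (D i))"
    proof -
      have int: "integrable M (indicator (D i) :: _ \<Rightarrow> real)" for i
        using D by (auto simp: emeasure_eq_measure)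
      have "(\<integral>\<omega>. (\<Sum>i<n. indicator (D i) \<omega>) \<partial>M) = (\<Sum>i<n. prob (D i))"
        using D int by (subst Bochner_Integration.integral_sum) auto
      moreover have "integrable M (\<lambda>\<omega>. \<Sum>i<n. indicator (D i) \<omega> :: real)"
        using int by (rule Bochner_Integration.integrable_sum)
      ultimately show ?thesis
        by (subst Bochner_Integration.integral_add) (auto simp: prob_space)
    qed
    finally show ?thesis using less by (simp add: pos_le_divide_eq algebra_simps)
  qed
  \<comment> \<open>The tail-sum formula asks for a measurable \<open>N\<close>; every fibre is a
    countable Boolean combination of the events \<open>D k\<close>.\<close>
  have meas: "N \<in> measurable M (count_space UNIV)"
  proof (rule measurable_count_space_eq2_countable[THEN iffD2], intro conjI ballI)
    fix a :: enat
    show "N -` {a} \<inter> space M \<in> sets M"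
    proof (cases a)
      case (enat m)
      have "N \<omega> = enat m \<longleftrightarrow> (\<forall>k<m. enat k < N \<omega>) \<and> \<not> enat m < N \<omega>" for \<omega>
        by (cases "N \<omega>") (simp_all, metis less_irrefl linorder_neqE_nat)
      then have "N -` {a} \<inter> space M = space M \<inter> (\<Inter>k<m. D k) - D m"
        using enat by (auto simp: D_def)
      moreover have "space M \<inter> (\<Inter>k<m. D k) \<in> sets M"
        using D by (cases "m = 0") (auto intro!: sets.Int sets.finite_INT)
      ultimately show ?thesis using D by auto
    next
      case infinity
      have "N \<omega> = \<infinity> \<longleftrightarrow> (\<forall>k. enat k < N \<omega>)" for \<omega>
        by (cases "N \<omega>") auto
      then have "N -` {a} \<inter> space M = (\<Inter>k. D k)"
        using infinity by (auto simp: D_def)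
      then show ?thesis using D by auto
    qed
  qed auto
  have "(\<integral>\<^sup>+\<omega>. ennreal_of_enat (N \<omega>) \<partial>M) = (\<Sum>k. emeasure M (D k))"
    using nn_integral_enat_function[OF meas] by (simp add: D_def)
  also have "\<dots> \<le> ennreal (K / (p - \<kappa>))"
  proof (rule suminf_le_const[OF summableI])
    fix n
    show "(\<Sum>i<n. emeasure M (D i)) \<le> ennreal (K / (p - \<kappa>))"
      using bound[of n] by (simp add: emeasure_eq_measure ennreal_leI sum_ennreal)
  qed
  finally show ?thesis .
qed

section \<open>The filtration generated by gradient estimates and noise values\<close>

lemma sets_history:
  "sets (history P G E E' k) = sigma_sets (space P)
     ({G j -` B \<inter> space P | j B. j < k \<and> B \<in> sets borel} \<union>
      {E j -` B \<inter> space P | j B. j < k \<and> B \<in> sets borel} \<union>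
      {E' j -` B \<inter> space P | j B. j < k \<and> B \<in> sets borel})"
  unfolding history_def by (rule sets_measure_of) auto

lemma space_history [simp]: "space (history P G E E' k) = space P"
  unfolding history_def by (rule space_measure_of) auto

lemma history_measurable:
  assumes "j < k"
  shows "G j \<in> borel_measurable (history P G E E' k)"
    and "E j \<in> borel_measurable (history P G E E' k)"
    and "E' j \<in> borel_measurable (history P G E E' k)"
proof -
  show "G j \<in> borel_measurable (history P G E E' k)"
    by (rule measurableI) (use assms in \<open>auto simp: sets_history intro!: sigma_sets.Basic\<close>)
  show "E j \<in> borel_measurable (history P G E E' k)"
    by (rule measurableI) (use assms in \<open>auto simp: sets_history intro!: sigma_sets.Basic\<close>)
  show "E' j \<in> borel_measurable (history P G E E' k)"
    by (rule measurableI) (use assms in \<open>auto simp: sets_history intro!: sigma_sets.Basic\<close>)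
qed

lemma history_mono:
  assumes "j \<le> k"
  shows "sets (history P G E E' j) \<subseteq> sets (history P G E E' k)"
  unfolding sets_history
  by (intro sigma_sets_mono' Un_mono) (use assms less_le_trans in blast)+

lemma history_subalgebra:
  assumes "\<And>k. G k \<in> borel_measurable P" "\<And>k. E k \<in> borel_measurable P"
    "\<And>k. E' k \<in> borel_measurable P"
  shows "subalgebra P (history P G E E' k)"
  unfolding subalgebra_def sets_history
  using assms by (auto intro!: sets.sigma_sets_subset measurable_sets)


section \<open>Deterministic analysis of a single iteration\<close>

locale noisy_line_search =
  fixes \<phi> :: "'v::euclidean_space \<Rightarrow> real"
    and grad\<phi> :: "'v \<Rightarrow> 'v"
    and f :: "'v \<Rightarrow> 's \<Rightarrow> real"
    and L \<mu> \<epsilon>f \<epsilon> \<gamma> \<theta> c1 \<alpha>bar M :: real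
    and xstar :: 'v
  assumes gradient: "\<And>x. GDERIV \<phi> x :> grad\<phi> x"
    and Lipschitz: "L-lipschitz_on UNIV grad\<phi>"
    and \<mu>_pos: "0 < \<mu>"
    and strongly_convex:
      "\<And>x y. \<phi> x \<ge> \<phi> y + grad\<phi> y \<bullet> (x - y) + \<mu> / 2 * (norm (x - y))\<^sup>2"
    and minimizer: "\<And>x. \<phi> xstar \<le> \<phi> x"
    and bounded_noise: "\<And>x s. \<bar>f x s - \<phi> x\<bar> \<le> \<epsilon>f"
    and c1: "0 < c1" "c1 < 1"
    and \<theta>: "0 \<le> \<theta>" "\<theta> < (1 - c1) / (2 - c1)"
    and \<gamma>: "0 < \<gamma>" "\<gamma> < 1"
    and M_def: "M = 1 - 2 * \<mu> * c1 * (1 - \<theta>) * (1 - 2 * \<theta> - c1 * (1 - \<theta>)) / L"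
    and \<alpha>bar_def: "\<alpha>bar = 2 * (1 - 2 * \<theta> - c1 * (1 - \<theta>)) / (L * (1 - \<theta>))"
    and \<epsilon>_pos: "0 < \<epsilon>"
    and \<epsilon>_large: "\<epsilon> > 4 * \<epsilon>f / (M powr (- \<gamma>) - 1)"
begin

definition accurate_grad :: "'v \<Rightarrow> 'v \<Rightarrow> bool" where
  "accurate_grad x g \<longleftrightarrow> norm (g - grad\<phi> x) \<le> \<theta> * norm (grad\<phi> x)"

definition gap :: "'v \<Rightarrow> real" where
  "gap x = \<phi> x - \<phi> xstar"

definition log_gap :: "'v \<Rightarrow> real" where
  "log_gap x = log (1 / M) (gap x / \<epsilon>)"

text \<open>The expression equals \<open>1 - c1 - \<theta> * (2 - c1)\<close>, so the upper bound on
  \<theta> is exactly what makes it positive. This yields both \<open>0 < \<alpha>bar\<close> and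
  \<open>M < 1\<close>.\<close>

lemma margin_pos: "0 < 1 - 2 * \<theta> - c1 * (1 - \<theta>)"
  using \<theta>(2) c1 by (simp add: pos_less_divide_eq algebra_simps)

lemma \<theta>_less_1: "\<theta> < 1"
proof -
  have "(1 - c1) / (2 - c1) < 1" using c1 by simp
  then show ?thesis using \<theta>(2) by linarith
qed

text \<open>The quadratic upper and lower bounds on \<phi> are compared along a unit vector.\<close>

lemma \<mu>_le_L: "\<mu> \<le> L"
proof -
  obtain e :: 'v where "e \<in> Basis" using nonempty_Basis by blast
  then have "norm e = 1" by simp
  then show ?thesis
    using descent_lemma[OF gradient Lipschitz, of 0 e] strongly_convex[of 0 e] by simp
qed

lemma L_pos: "0 < L"
  using \<mu>_le_L \<mu>_pos by linarith

lemma \<alpha>bar_pos: "0 < \<alpha>bar"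
  unfolding \<alpha>bar_def using margin_pos L_pos \<theta>_less_1 by simp

text \<open>The lower bound combines \<open>\<mu> / L \<le> 1\<close> with
  \<open>c1 * (1 - c1) \<le> 1 / 4\<close>. Besides making \<open>1 / M\<close> a valid logarithm
  base, it gives \<open>M powr (- \<gamma>) \<le> 2\<close>, on which the noise absorption
  rests.\<close>

lemma M_bounds: "1 / 2 \<le> M" "M < 1"
proof -
  define r where "r = 1 - 2 * \<theta> - c1 * (1 - \<theta>)"
  have r: "0 < r" using margin_pos by (simp add: r_def)
  have M_eq: "M = 1 - 2 * (\<mu> / L * ((1 - \<theta>) * (c1 * r)))"
    by (simp add: M_def r_def)
  have "0 \<le> \<theta> * (2 - c1)" using \<theta> c1 by simp
  then have "r \<le> 1 - c1" by (simp add: r_def algebra_simps)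
  then have "c1 * r \<le> c1 * (1 - c1)" using c1 by simp
  also have "\<dots> \<le> 1 / 4"
    using zero_le_power2[of "c1 - 1 / 2"] by (simp add: power2_eq_square algebra_simps)
  finally have 1: "c1 * r \<le> 1 / 4" .
  have "\<mu> / L * ((1 - \<theta>) * (c1 * r)) \<le> 1 * (1 * (1 / 4))"
    using 1 \<mu>_le_L L_pos \<mu>_pos \<theta> \<theta>_less_1 c1 r by (intro mult_mono) auto
  then show "1 / 2 \<le> M" unfolding M_eq by linarith
  have "0 < \<mu> / L * ((1 - \<theta>) * (c1 * r))"
    using L_pos \<mu>_pos \<theta>_less_1 c1 r by simp
  then show "M < 1" unfolding M_eq by linarith
qed

lemma gap_nonneg: "0 \<le> gap x"
  using minimizer by (simp add: gap_def)

lemma gradient_dominated: "2 * \<mu> * gap x \<le> (norm (grad\<phi> x))\<^sup>2"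
  unfolding gap_def by (rule Polyak_Lojasiewicz[OF \<mu>_pos strongly_convex])

lemma accurate_grad_norm:
  assumes "accurate_grad x g"
  shows "(1 - \<theta>) * norm (grad\<phi> x) \<le> norm g"
  using assms norm_triangle_ineq2[of "grad\<phi> x" g]
  by (simp add: accurate_grad_def algebra_simps norm_minus_commute)

text \<open>The threshold \<open>\<alpha>bar\<close> is the step size up to which the quadratic term
  of the descent lemma fits between the inner product bound and the demanded decrease. The slack
  \<open>2 * \<epsilon>f\<close> of the test covers the noise of both evaluations.\<close>

lemma sufficient_decrease_if_short_step:
  assumes acc: "accurate_grad x g" and \<alpha>: "0 < \<alpha>" "\<alpha> \<le> \<alpha>bar"
  shows "sufficient_decrease f c1 \<epsilon>f x \<alpha> g (- g) s s'"
proof -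
  define r where "r = 1 - 2 * \<theta> - c1 * (1 - \<theta>)"
  have \<theta>1: "0 < 1 - \<theta>" using \<theta>_less_1 by simp
  have "norm g * norm g - grad\<phi> x \<bullet> g = (g - grad\<phi> x) \<bullet> g"
    by (simp add: inner_diff_left power2_norm_eq_inner[symmetric] power2_eq_square)
  also have "\<dots> \<le> norm (g - grad\<phi> x) * norm g" by (rule norm_cauchy_schwarz)
  also have "\<dots> \<le> (\<theta> * norm (grad\<phi> x)) * norm g"
    using acc by (intro mult_right_mono) (auto simp: accurate_grad_def)
  finally have "(1 - \<theta>) * (norm g * norm g - grad\<phi> x \<bullet> g)
      \<le> (1 - \<theta>) * ((\<theta> * norm (grad\<phi> x)) * norm g)"
    using \<theta>1 by simp
  also have "\<dots> = \<theta> * ((1 - \<theta>) * norm (grad\<phi> x)) * norm g" by simp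
  also have "\<dots> \<le> \<theta> * norm g * norm g"
    using accurate_grad_norm[OF acc] \<theta> by (intro mult_right_mono mult_left_mono) auto
  \<comment> \<open>Accuracy bounds \<open>(1 - \<theta>) * norm (grad\<phi> x)\<close> by
    \<open>norm g\<close>, so the true gradient norm disappears from the estimate.\<close>
  finally have inner: "(1 - 2 * \<theta>) * (norm g)\<^sup>2 \<le> (1 - \<theta>) * (grad\<phi> x \<bullet> g)"
    by (simp add: algebra_simps power2_eq_square)
  have "(1 - \<theta>) * L * \<alpha> / 2 \<le> r"
    using \<alpha> L_pos \<theta>1 unfolding \<alpha>bar_def r_def[symmetric] by (simp add: pos_le_divide_eq mult_ac)
  then have step: "(1 - \<theta>) * L * \<alpha> / 2 * (norm g)\<^sup>2 \<le> r * (norm g)\<^sup>2"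
    by (intro mult_right_mono) auto
  have "(1 - \<theta>) * (L / 2 * \<alpha> * (norm g)\<^sup>2 - grad\<phi> x \<bullet> g) \<le> (1 - \<theta>) * (- c1 * (norm g)\<^sup>2)"
    using inner step by (simp add: r_def algebra_simps)
  then have "L / 2 * \<alpha> * (norm g)\<^sup>2 - grad\<phi> x \<bullet> g \<le> - c1 * (norm g)\<^sup>2"
    using \<theta>1 by (rule mult_left_le_imp_le)
  then have "\<alpha> * (L / 2 * \<alpha> * (norm g)\<^sup>2 - grad\<phi> x \<bullet> g) \<le> \<alpha> * (- c1 * (norm g)\<^sup>2)"
    using \<alpha> by (intro mult_left_mono) auto
  moreover have "\<phi> (x + \<alpha> *\<^sub>R (- g)) \<le> \<phi> x - \<alpha> * (grad\<phi> x \<bullet> g) + L / 2 * (\<alpha>\<^sup>2 * (norm g)\<^sup>2)"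
    using descent_lemma[OF gradient Lipschitz, of x "\<alpha> *\<^sub>R (- g)"]
    by (simp add: power_mult_distrib)
  ultimately have "\<phi> (x + \<alpha> *\<^sub>R (- g)) \<le> \<phi> x - c1 * \<alpha> * (norm g)\<^sup>2"
    by (simp add: algebra_simps power2_eq_square)
  then show ?thesis
    using bounded_noise[of x s] bounded_noise[of "x + \<alpha> *\<^sub>R (- g)" s']
    by (simp add: sufficient_decrease_def power2_norm_eq_inner abs_le_iff)
qed

text \<open>The constant \<open>4 * \<epsilon>f\<close> is the slack \<open>2 * \<epsilon>f\<close>
  of the test plus \<epsilon>f for each of the two evaluations.\<close>

lemma gap_success:
  assumes "sufficient_decrease f c1 \<epsilon>f x \<alpha> g (- g) s s'"
  shows "gap (x + \<alpha> *\<^sub>R (- g)) \<le> gap x - c1 * \<alpha> * (norm g)\<^sup>2 + 4 * \<epsilon>f"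
  using assms bounded_noise[of x s] bounded_noise[of "x + \<alpha> *\<^sub>R (- g)" s']
  by (simp add: sufficient_decrease_def gap_def power2_norm_eq_inner abs_le_iff)

text \<open>The guaranteed relative decrease is \<open>2 * (1 - M)\<close>, twice what the factor
  \<open>M\<close> would require; the surplus later absorbs the noise.\<close>

lemma gap_contraction:
  assumes acc: "accurate_grad x g" and \<alpha>: "\<alpha>bar \<le> \<alpha>"
    and success: "sufficient_decrease f c1 \<epsilon>f x \<alpha> g (- g) s s'"
  shows "gap (x + \<alpha> *\<^sub>R (- g)) \<le> (2 * M - 1) * gap x + 4 * \<epsilon>f"
proof -
  have \<theta>1: "0 < 1 - \<theta>" using \<theta>_less_1 by simp
  have "2 * (1 - M) = c1 * \<alpha>bar * ((1 - \<theta>)\<^sup>2 * (2 * \<mu>))"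
  proof -
    define r where "r = 1 - 2 * \<theta> - c1 * (1 - \<theta>)"
    have "M = 1 - 2 * \<mu> * c1 * (1 - \<theta>) * r / L" "\<alpha>bar = 2 * r / (L * (1 - \<theta>))"
      by (simp_all only: M_def \<alpha>bar_def r_def)
    then show ?thesis using L_pos \<theta>1 by (simp add: power2_eq_square)
  qed
  then have "2 * (1 - M) * gap x = c1 * \<alpha>bar * ((1 - \<theta>)\<^sup>2 * (2 * \<mu> * gap x))" by simp
  also have "\<dots> \<le> c1 * \<alpha>bar * ((1 - \<theta>)\<^sup>2 * (norm (grad\<phi> x))\<^sup>2)"
    using c1 \<alpha>bar_pos gradient_dominated by (intro mult_left_mono) auto
  also have "\<dots> \<le> c1 * \<alpha> * (norm g)\<^sup>2"
    using c1 \<alpha> \<alpha>bar_pos \<theta>1 power_mono[OF accurate_grad_norm[OF acc], of 2]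
    by (intro mult_mono) (auto simp: power_mult_distrib)
  finally show ?thesis
    using gap_success[OF success] by (simp add: algebra_simps)
qed

lemma noise_small: "4 * \<epsilon>f \<le> \<epsilon> * (M powr (- \<gamma>) - 1)"
proof -
  have "1 < M powr (- \<gamma>)"
    using powr_less_mono'[of M "- \<gamma>" 0] M_bounds \<gamma> by simp
  then show ?thesis using \<epsilon>_large by (simp add: pos_divide_less_eq)
qed

lemma log_gap_le:
  assumes "\<epsilon> < gap x" "\<epsilon> < gap y" and le: "gap y \<le> gap x * M powr (- t)"
  shows "log_gap y \<le> log_gap x + t"
proof -
  have M: "0 < M" "1 < 1 / M" using M_bounds by (auto simp: field_simps)
  have "gap y / \<epsilon> \<le> gap x * M powr (- t) / \<epsilon>"
    using le \<epsilon>_pos by (intro divide_right_mono) auto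
  also have "\<dots> = gap x / \<epsilon> * (1 / M) powr t"
    using M by (simp add: powr_divide powr_minus_divide)
  finally have "log_gap y \<le> log (1 / M) (gap x / \<epsilon> * (1 / M) powr t)"
    unfolding log_gap_def using assms M \<epsilon>_pos by (subst log_le_cancel_iff) auto
  also have "\<dots> = log_gap x + t"
    unfolding log_gap_def using assms M \<epsilon>_pos by (subst log_mult_pos) auto
  finally show ?thesis .
qed

lemma log_gap_success:
  assumes gaps: "\<epsilon> < gap x" "\<epsilon> < gap (x + \<alpha> *\<^sub>R (- g))" and "0 < \<alpha>"
    and success: "sufficient_decrease f c1 \<epsilon>f x \<alpha> g (- g) s s'"
  shows "log_gap (x + \<alpha> *\<^sub>R (- g)) \<le> log_gap x + \<gamma>"
    and "accurate_grad x g \<Longrightarrow> \<alpha>bar \<le> \<alpha> \<Longrightarrow>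
      log_gap (x + \<alpha> *\<^sub>R (- g)) \<le> log_gap x - (1 - \<gamma>)"
proof -
  have M: "0 < M" using M_bounds by simp
  have powr1: "1 \<le> M powr (- \<gamma>)"
    using powr_mono'[of "- \<gamma>" 0 M] M_bounds \<gamma> by simp
  \<comment> \<open>Above the accuracy \<epsilon> the additive noise becomes a multiple of the gap,
    hence an additive term on the logarithmic scale.\<close>
  have "\<epsilon> * (M powr (- \<gamma>) - 1) \<le> gap x * (M powr (- \<gamma>) - 1)"
    using gaps powr1 by (intro mult_right_mono) auto
  then have noise: "4 * \<epsilon>f \<le> gap x * (M powr (- \<gamma>) - 1)"
    using noise_small by linarith
  have "0 \<le> c1 * \<alpha> * (norm g)\<^sup>2" using c1 \<open>0 < \<alpha>\<close> by simp
  then have "gap (x + \<alpha> *\<^sub>R (- g)) \<le> gap x * M powr (- \<gamma>)"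
    using gap_success[OF success] noise by (simp add: algebra_simps)
  then show "log_gap (x + \<alpha> *\<^sub>R (- g)) \<le> log_gap x + \<gamma>"
    by (rule log_gap_le[OF gaps])
  assume "accurate_grad x g" "\<alpha>bar \<le> \<alpha>"
  \<comment> \<open>Contraction factor plus relative noise must stay below
    \<open>M powr (1 - \<gamma>)\<close>; the difference factors as
    \<open>(1 - M) * (2 - M powr (- \<gamma>))\<close>.\<close>
  have "M powr (- \<gamma>) \<le> M powr (- 1)"
    using M_bounds \<gamma> by (intro powr_mono') auto
  also have "\<dots> \<le> 2" using M_bounds by (simp add: powr_minus field_simps)
  finally have "0 \<le> (1 - M) * (2 - M powr (- \<gamma>))"
    using M_bounds by simp
  then have "2 * M - 1 + (M powr (- \<gamma>) - 1) \<le> M * M powr (- \<gamma>)"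
    by (simp add: algebra_simps)
  also have "M * M powr (- \<gamma>) = M powr (- (\<gamma> - 1))"
    using M by (simp add: powr_diff powr_minus field_simps)
  finally have "gap x * (2 * M - 1 + (M powr (- \<gamma>) - 1)) \<le> gap x * M powr (- (\<gamma> - 1))"
    using gap_nonneg by (intro mult_left_mono) auto
  then have "gap (x + \<alpha> *\<^sub>R (- g)) \<le> gap x * M powr (- (\<gamma> - 1))"
    using gap_contraction[OF \<open>accurate_grad x g\<close> \<open>\<alpha>bar \<le> \<alpha>\<close> success] noise
    by (simp add: algebra_simps)
  then show "log_gap (x + \<alpha> *\<^sub>R (- g)) \<le> log_gap x - (1 - \<gamma>)"
    using log_gap_le[OF gaps, of "\<gamma> - 1"] by simp
qed

lemma log_gap_nonneg:
  assumes "\<epsilon> < gap x"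
  shows "0 \<le> log_gap x"
  unfolding log_gap_def using assms M_bounds \<epsilon>_pos by (subst zero_le_log_cancel_iff) auto

section \<open>Counting accurate iterations along a path\<close>

context
  fixes x0 :: 'v and \<tau> \<alpha>0 :: real and g x :: "nat \<Rightarrow> 'v"
    and s s' :: "nat \<Rightarrow> 's" and \<alpha> :: "nat \<Rightarrow> real"
  assumes run: "line_search_run f \<tau> c1 \<epsilon>f x0 \<alpha>0 g s s' x \<alpha>"
    and \<tau>_pos: "0 < \<tau>" and \<alpha>0_pos: "0 < \<alpha>0"
begin

lemma run_init: "x 0 = x0" "\<alpha> 0 = \<alpha>0"
  using run by (simp_all add: line_search_run_def)

lemma step_cases:
  obtains
    (success) "sufficient_decrease f c1 \<epsilon>f (x k) (\<alpha> k) (g k) (- g k) (s k) (s' k)"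
      "x (Suc k) = x k + \<alpha> k *\<^sub>R (- g k)" "\<alpha> (Suc k) = inverse \<tau> * \<alpha> k"
  | (failure) "\<not> sufficient_decrease f c1 \<epsilon>f (x k) (\<alpha> k) (g k) (- g k) (s k) (s' k)"
      "x (Suc k) = x k" "\<alpha> (Suc k) = \<tau> * \<alpha> k"
  using run by (auto simp: line_search_run_def Let_def split: if_splits)

lemma step_size_pos: "0 < \<alpha> k"
proof (induction k)
  case (Suc k)
  then show ?case by (cases rule: step_cases[of k]) (use \<tau>_pos in auto)
qed (simp add: run_init \<alpha>0_pos)

text \<open>The weights of the potential are balanced: whether the iteration succeeds or fails, and
  whether its gradient is accurate or not, the bounds on the individual changes add up to at most
  \<open>(1 + \<gamma>) / 2\<close>, the accurate iteration itself being counted as 1.\<close>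

lemma potential_decrease:
  assumes "\<And>k. k \<le> n \<Longrightarrow> \<epsilon> < gap (x k)" and "\<tau> \<le> 1" and "\<alpha>bar = \<tau> ^ c * \<alpha>0"
  shows "\<exists>m :: int. \<alpha> n = \<alpha>bar * \<tau> powi (- m) \<and>
    log_gap (x n) + (\<bar>m\<bar> - \<gamma> * m) / 2 + (\<Sum>i<n. of_bool (accurate_grad (x i) (g i)))
      \<le> log_gap x0 + (1 - \<gamma>) / 2 * c + (1 + \<gamma>) / 2 * n"
  using assms(1)
proof (induction n)
  case 0
  \<comment> \<open>The level starts at \<open>c\<close>, where
    \<open>\<bar>m\<bar> - \<gamma> * m\<close> equals \<open>(1 - \<gamma>) * c\<close>.\<close>
  have "\<alpha> 0 = \<alpha>bar * \<tau> powi (- int c)"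
    using \<tau>_pos assms(3) by (simp add: run_init power_int_minus)
  then show ?case
    by (intro exI[of _ "int c"]) (simp add: run_init algebra_simps)
next
  case (Suc n)
  from Suc.IH Suc.prems obtain m :: int where m: "\<alpha> n = \<alpha>bar * \<tau> powi (- m)"
    and le: "log_gap (x n) + (\<bar>m\<bar> - \<gamma> * m) / 2 + (\<Sum>i<n. of_bool (accurate_grad (x i) (g i)))
      \<le> log_gap x0 + (1 - \<gamma>) / 2 * c + (1 + \<gamma>) / 2 * n"
    by auto
  have gaps: "\<epsilon> < gap (x n)" "\<epsilon> < gap (x (Suc n))" using Suc.prems by auto
  have short: "\<alpha> n \<le> \<alpha>bar" if "m \<le> 0"
    unfolding m using that \<alpha>bar_pos \<tau>_pos assms(2) by (simp add: mult_left_le power_int_le_one)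
  have long: "\<alpha>bar \<le> \<alpha> n" if "0 \<le> m"
    using that \<alpha>bar_pos \<tau>_pos assms(2) one_le_inverse[of "\<tau> powi m"] power_int_le_one[of \<tau> m]
    unfolding m by (simp add: power_int_minus)
  show ?case
  proof (cases rule: step_cases[of n])
    case success
    have "\<tau> powi (- (m + 1)) = inverse \<tau> * \<tau> powi (- m)"
      unfolding power_int_minus using \<tau>_pos by (simp add: power_int_add_1)
    then have step: "\<alpha> (Suc n) = \<alpha>bar * \<tau> powi (- (m + 1))"
      unfolding success m by simp
    have gap': "\<epsilon> < gap (x n + \<alpha> n *\<^sub>R (- g n))" using gaps success by simp
    note log_gap_le' = log_gap_success[OF gaps(1) gap' step_size_pos success(1), folded success(2)]
    have "log_gap (x (Suc n)) + (\<bar>m + 1\<bar> - \<gamma> * (m + 1)) / 2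
        + of_bool (accurate_grad (x n) (g n)) \<le> log_gap (x n) + (\<bar>m\<bar> - \<gamma> * m) / 2 + (1 + \<gamma>) / 2"
    proof (cases "accurate_grad (x n) (g n) \<and> 0 \<le> m")
      case True
      then show ?thesis using log_gap_le'(2) long
        by (simp add: algebra_simps add_divide_distrib diff_divide_distrib)
    next
      case False
      \<comment> \<open>An accurate gradient in this case means \<open>m < 0\<close>: the
        logarithmic gap may rise by \<gamma>, but the level moves towards 0 and pays for it.\<close>
      have "\<bar>m + 1\<bar> \<le> \<bar>m\<bar> + 1 - 2 * of_bool (accurate_grad (x n) (g n))"
        using False by auto
      then have "real_of_int \<bar>m + 1\<bar> \<le> \<bar>m\<bar> + 1 - 2 * of_bool (accurate_grad (x n) (g n))"
        by linarith
      then show ?thesis using log_gap_le'(1)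
        by (simp add: algebra_simps add_divide_distrib diff_divide_distrib)
    qed
    then show ?thesis
      using le by (intro exI[of _ "m + 1"])
        (simp add: step algebra_simps add_divide_distrib diff_divide_distrib)
  next
    case failure
    have step: "\<alpha> (Suc n) = \<alpha>bar * \<tau> powi (- (m - 1))"
      using \<tau>_pos by (simp add: failure m power_int_diff power_int_minus field_simps)
    \<comment> \<open>At a level \<open>m \<le> 0\<close> the step is at most
      \<open>\<alpha>bar\<close>, so an accurate gradient would have forced success.\<close>
    have "0 < m" if "accurate_grad (x n) (g n)"
      using sufficient_decrease_if_short_step[OF that step_size_pos short] failure(1)
      by (meson not_le)
    then have "\<bar>m - 1\<bar> + 2 * of_bool (accurate_grad (x n) (g n)) \<le> \<bar>m\<bar> + 1"
      by auto
    then have "\<bar>m - 1\<bar> + 2 * of_bool (accurate_grad (x n) (g n)) \<le> real_of_int \<bar>m\<bar> + 1"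
      by linarith
    then show ?thesis
      using le by (intro exI[of _ "m - 1"])
        (simp add: step failure algebra_simps add_divide_distrib diff_divide_distrib)
  qed
qed

text \<open>
  The last iteration may take the gap arbitrarily far below \<open>\<epsilon>\<close>, so it is not charged to the
  potential but counted as accurate; this is the extra summand of the bound.
\<close>

lemma accurate_count:
  assumes gaps: "\<And>k. k < n \<Longrightarrow> \<epsilon> < gap (x k)" and x0: "\<epsilon> < gap x0"
    and "\<tau> \<le> 1" and "\<alpha>bar = \<tau> ^ c * \<alpha>0"
  shows "(\<Sum>i<n. of_bool (accurate_grad (x i) (g i)))
    \<le> log_gap x0 + (1 - \<gamma>) / 2 * (c + 1) + (1 + \<gamma>) / 2 * n"
proof (cases n)
  case 0
  then show ?thesis using log_gap_nonneg[OF x0] \<gamma> by simp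
next
  case (Suc l)
  then obtain m :: int where
    m: "log_gap (x l) + (\<bar>m\<bar> - \<gamma> * m) / 2 + (\<Sum>i<l. of_bool (accurate_grad (x i) (g i)))
      \<le> log_gap x0 + (1 - \<gamma>) / 2 * c + (1 + \<gamma>) / 2 * l"
    using potential_decrease[of l c] gaps assms by auto
  have "0 \<le> log_gap (x l)" using log_gap_nonneg gaps Suc by simp
  moreover have "\<gamma> * m \<le> \<bar>m\<bar>"
    using \<gamma> mult_right_mono[of \<gamma> 1 "\<bar>real_of_int m\<bar>"]
      mult_left_mono[of m "\<bar>real_of_int m\<bar>" \<gamma>] by linarith
  \<comment> \<open>The last iteration costs 1 instead of \<open>(1 + \<gamma>) / 2\<close>; the
    excess \<open>(1 - \<gamma>) / 2\<close> turns \<open>c\<close> into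
    \<open>c + 1\<close>.\<close>
  moreover have "of_bool (accurate_grad (x l) (g l)) \<le> (1 :: real)" by simp
  ultimately show ?thesis
    using m Suc by (simp add: algebra_simps add_divide_distrib diff_divide_distrib)
qed

text \<open>The step size always equals \<open>\<alpha>bar\<close>, so an accurate iteration both
  succeeds and contracts. The logarithmic gap plus the count then grows by at most \<gamma> per
  iteration, and \<open>1 - \<gamma>\<close> is the excess cost of the last one.\<close>

lemma accurate_count_constant_step:
  assumes gaps: "\<And>k. k < n \<Longrightarrow> \<epsilon> < gap (x k)" and x0: "\<epsilon> < gap x0"
    and "\<tau> = 1" and "\<alpha>bar = \<alpha>0"
  shows "(\<Sum>i<n. of_bool (accurate_grad (x i) (g i))) \<le> log_gap x0 + (1 - \<gamma>) + \<gamma> * n"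
proof -
  have \<alpha>: "\<alpha> k = \<alpha>bar" for k
  proof (induction k)
    case (Suc k)
    then show ?case by (cases rule: step_cases[of k]) (use assms in auto)
  qed (simp add: run_init assms)
  have le: "log_gap (x l) + (\<Sum>i<l. of_bool (accurate_grad (x i) (g i))) \<le> log_gap x0 + \<gamma> * l"
    if "\<And>k. k \<le> l \<Longrightarrow> \<epsilon> < gap (x k)" for l
    using that
  proof (induction l)
    case (Suc l)
    have gaps: "\<epsilon> < gap (x l)" "\<epsilon> < gap (x (Suc l))" using Suc.prems by auto
    have IH: "log_gap (x l) + (\<Sum>i<l. of_bool (accurate_grad (x i) (g i))) \<le> log_gap x0 + \<gamma> * l"
      using Suc by simp
    show ?case
    proof (cases rule: step_cases[of l])
      case success
      have gap': "\<epsilon> < gap (x l + \<alpha> l *\<^sub>R (- g l))" using gaps success by simp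
      note log_gap_le' = log_gap_success[OF gaps(1) gap' step_size_pos success(1), folded success(2)]
      show ?thesis
        using IH log_gap_le' \<alpha>[of l]
        by (cases "accurate_grad (x l) (g l)") (auto simp: algebra_simps)
    next
      case failure
      then have "\<not> accurate_grad (x l) (g l)"
        using sufficient_decrease_if_short_step[OF _ step_size_pos] \<alpha>[of l] by auto
      then show ?thesis using IH failure \<gamma> by (simp add: algebra_simps)
    qed
  qed (simp add: run_init)
  show ?thesis
  proof (cases n)
    case 0
    then show ?thesis using log_gap_nonneg[OF x0] \<gamma> by simp
  next
    case (Suc l)
    have "0 \<le> log_gap (x l)" using log_gap_nonneg gaps Suc by simp
    moreover have "of_bool (accurate_grad (x l) (g l)) \<le> (1 :: real)" by simp
    ultimately show ?thesis
      using le[of l] gaps Suc by (simp add: algebra_simps)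
  qed
qed

end

end

section \<open>Adaptedness of the iterates and the stopping index\<close>

text \<open>The values of \<open>f\<close> enter the test only as \<phi> plus noise. The outcome of
  iteration \<open>k\<close> is therefore the predicate \<open>S\<close> in \<open>X k\<close>,
  \<open>A k\<close>, \<open>G k\<close>, \<open>E k\<close> and \<open>E' k\<close>, all known to
  the history at \<open>Suc k\<close>.\<close>

lemma line_search_history_measurable:
  fixes \<phi> :: "'v::euclidean_space \<Rightarrow> real"
  assumes \<phi>: "\<phi> \<in> borel_measurable borel"
    and run: "\<And>\<omega>. \<omega> \<in> space P \<Longrightarrow>
      line_search_run f \<tau> c1 \<epsilon>f x0 \<alpha>0 (\<lambda>k. G k \<omega>) (\<lambda>k. \<xi> k \<omega>) (\<lambda>k. \<xi>' k \<omega>)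
        (\<lambda>k. X k \<omega>) (\<lambda>k. A k \<omega>)"
    and E: "E = function_noise \<phi> f X \<xi>"
    and E': "E' = function_noise \<phi> f (\<lambda>k \<omega>. X k \<omega> + A k \<omega> *\<^sub>R (- G k \<omega>)) \<xi>'"
  shows "X k \<in> borel_measurable (history P G E E' k) \<and> A k \<in> borel_measurable (history P G E E' k)"
proof (induction k)
  case 0
  have "X 0 \<omega> = x0" "A 0 \<omega> = \<alpha>0" if "\<omega> \<in> space P" for \<omega>
    using run[OF that] by (auto simp: line_search_run_def)
  then show ?case
    using measurable_cong[of "history P G E E' 0" "X 0" "\<lambda>_. x0" borel]
      measurable_cong[of "history P G E E' 0" "A 0" "\<lambda>_. \<alpha>0" borel] by simp
next
  case (Suc k)
  let ?F = "history P G E E' (Suc k)"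
  have lift: "h \<in> borel_measurable ?F" if "h \<in> borel_measurable (history P G E E' k)"
    for h :: "_ \<Rightarrow> 'x::topological_space"
    using that history_mono[of k "Suc k" P G E E'] by (auto simp: measurable_def)
  have X [measurable]: "X k \<in> borel_measurable ?F" and A [measurable]: "A k \<in> borel_measurable ?F"
    using Suc.IH by (auto intro: lift)
  have [measurable]: "G k \<in> borel_measurable ?F" "E k \<in> borel_measurable ?F" "E' k \<in> borel_measurable ?F"
    by (rule history_measurable; simp)+
  note \<phi> [measurable]
  define S where "S \<omega> \<longleftrightarrow> \<phi> (X k \<omega> + A k \<omega> *\<^sub>R (- G k \<omega>)) + E' k \<omega>
    \<le> \<phi> (X k \<omega>) + E k \<omega> + c1 * A k \<omega> * (- G k \<omega> \<bullet> G k \<omega>) + 2 * \<epsilon>f" for \<omega>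
  have [measurable]: "Measurable.pred ?F S" unfolding S_def by measurable
  have S: "sufficient_decrease f c1 \<epsilon>f (X k \<omega>) (A k \<omega>) (G k \<omega>) (- G k \<omega>) (\<xi> k \<omega>) (\<xi>' k \<omega>) \<longleftrightarrow> S \<omega>"
    for \<omega> by (simp add: sufficient_decrease_def S_def E E' function_noise_def)
  have X_Suc: "X (Suc k) \<omega> = (if S \<omega> then X k \<omega> + A k \<omega> *\<^sub>R (- G k \<omega>) else X k \<omega>)"
    and A_Suc: "A (Suc k) \<omega> = (if S \<omega> then inverse \<tau> * A k \<omega> else \<tau> * A k \<omega>)"
    if "\<omega> \<in> space ?F" for \<omega>
    using run[of \<omega>] that by (auto simp: line_search_run_def Let_def S split: if_splits)
  show ?case
  proof
    show "X (Suc k) \<in> borel_measurable ?F" by (subst measurable_cong[OF X_Suc]) measurable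
    show "A (Suc k) \<in> borel_measurable ?F" by (subst measurable_cong[OF A_Suc]) measurable
  qed
qed

lemma less_stopping_index_iff:
  "enat k < stopping_index \<phi> \<phi>star \<epsilon> X \<omega> \<longleftrightarrow> (\<forall>i\<le>k. \<epsilon> < \<phi> (X i \<omega>) - \<phi>star)"
proof
  assume "enat k < stopping_index \<phi> \<phi>star \<epsilon> X \<omega>"
  then have "enat k < enat i" if "\<phi> (X i \<omega>) - \<phi>star \<le> \<epsilon>" for i
    unfolding stopping_index_def by (rule less_INF_D) (use that in simp)
  then show "\<forall>i\<le>k. \<epsilon> < \<phi> (X i \<omega>) - \<phi>star" by (force simp: not_le[symmetric])
next
  assume "\<forall>i\<le>k. \<epsilon> < \<phi> (X i \<omega>) - \<phi>star"
  \<comment> \<open>A strict bound need not survive an infimum, so the weak bound with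
    \<open>Suc k\<close> is shown first. If the accuracy is never reached, the infimum is
    infinite.\<close>
  then have "enat (Suc k) \<le> stopping_index \<phi> \<phi>star \<epsilon> X \<omega>"
    unfolding stopping_index_def by (intro INF_greatest) (force simp: not_le[symmetric] not_less_eq_eq)
  then show "enat k < stopping_index \<phi> \<phi>star \<epsilon> X \<omega>"
    by (metis enat_ord_simps(2) lessI less_le_trans)
qed

section \<open>Comparison of drifts and the bound on the expectation\<close>

text \<open>With \<open>q = 1 - 2 * \<delta>\<close>, the last inequality says that the drift
  \<open>(q - \<gamma>) / 2\<close> of the potential is at least twice the claimed drift
  \<open>(q\<^sup>2 - \<gamma>) / (2 * (1 + q))\<close>. The difference of its sides is
  \<open>(1 - q) * (q + \<gamma>)\<close>.\<close>

lemma drift_comparison: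
  fixes \<gamma> q :: real
  assumes "0 < \<gamma>" "\<gamma> < 1" "sqrt \<gamma> < q" "q \<le> 1"
  shows "\<gamma> < q\<^sup>2" and "\<gamma> < q" and "2 * (q\<^sup>2 - \<gamma>) \<le> (1 + q) * (q - \<gamma>)"
proof -
  have "0 < sqrt \<gamma>" using assms by simp
  then have q: "0 < q" using assms by linarith
  show 1: "\<gamma> < q\<^sup>2" using assms q by (metis real_less_lsqrt real_sqrt_less_iff real_sqrt_abs abs_of_pos)
  have "q\<^sup>2 \<le> q" using q assms by (simp add: power2_eq_square mult_left_le)
  then show "\<gamma> < q" using 1 by linarith
  have "0 \<le> (1 - q) * (q + \<gamma>)" using assms q by simp
  then show "2 * (q\<^sup>2 - \<gamma>) \<le> (1 + q) * (q - \<gamma>)"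
    by (simp add: power2_eq_square algebra_simps)
qed

theorem theorem4p17:
  fixes \<phi> :: "real ^ 'n \<Rightarrow> real"
    and grad\<phi> :: "real ^ 'n \<Rightarrow> real ^ 'n"
    and f :: "real ^ 'n \<Rightarrow> 's \<Rightarrow> real"
    and L \<mu> \<epsilon>f \<epsilon> \<gamma> \<theta> \<delta> \<tau> c1 \<alpha>0 \<alpha>bar M :: real
    and x0 xstar :: "real ^ 'n"
    and P :: "'w measure"
    and G X :: "nat \<Rightarrow> 'w \<Rightarrow> real ^ 'n"
    and \<A> :: "nat \<Rightarrow> 'w \<Rightarrow> real"
    and \<xi> \<xi>' :: "nat \<Rightarrow> 'w \<Rightarrow> 's"
    and E E' :: "nat \<Rightarrow> 'w \<Rightarrow> real"
  assumes gradient: "\<And>x. GDERIV \<phi> x :> grad\<phi> x"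
    and C1: "continuous_on UNIV grad\<phi>"
    and Lipschitz: "L-lipschitz_on UNIV grad\<phi>"
    and \<mu>_pos: "0 < \<mu>"
    and strongly_convex:
      "\<And>x y. \<phi> x \<ge> \<phi> y + grad\<phi> y \<bullet> (x - y) + \<mu> / 2 * (norm (x - y))\<^sup>2"
    and minimizer: "\<And>x. \<phi> xstar \<le> \<phi> x"
    and \<epsilon>f_nonneg: "0 \<le> \<epsilon>f"
    and bounded_noise: "\<And>x s. \<bar>f x s - \<phi> x\<bar> \<le> \<epsilon>f"
    and \<alpha>0_pos: "0 < \<alpha>0"
    and \<tau>: "0 < \<tau>" "\<tau> \<le> 1"
    and c1: "0 < c1" "c1 < 1"
    and \<theta>: "0 \<le> \<theta>" "\<theta> < (1 - c1) / (2 - c1)"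
    and \<gamma>: "0 < \<gamma>" "\<gamma> < 1"
    and \<delta>: "\<delta> < 1 / 2 - sqrt \<gamma> / 2"
    and M_def: "M = 1 - 2 * \<mu> * c1 * (1 - \<theta>) * (1 - 2 * \<theta> - c1 * (1 - \<theta>)) / L"
    and \<alpha>bar_def: "\<alpha>bar = 2 * (1 - 2 * \<theta> - c1 * (1 - \<theta>)) / (L * (1 - \<theta>))"
    and step_size_convention: "\<exists>c::nat. 0 < c \<and> \<alpha>bar = \<tau> ^ c * \<alpha>0"
    and \<epsilon>_pos: "0 < \<epsilon>"
    and \<epsilon>_large: "\<epsilon> > 4 * \<epsilon>f / (M powr (- \<gamma>) - 1)"
    and P: "prob_space P"
    and G_measurable: "\<And>k. G k \<in> borel_measurable P"
    and run: "\<And>\<omega>. \<omega> \<in> space P \<Longrightarrow>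
      line_search_run f \<tau> c1 \<epsilon>f x0 \<alpha>0 (\<lambda>k. G k \<omega>) (\<lambda>k. \<xi> k \<omega>) (\<lambda>k. \<xi>' k \<omega>)
        (\<lambda>k. X k \<omega>) (\<lambda>k. \<A> k \<omega>)"
    and E_def: "E = function_noise \<phi> f X \<xi>"
    and E'_def: "E' = function_noise \<phi> f (\<lambda>k \<omega>. X k \<omega> + \<A> k \<omega> *\<^sub>R (- G k \<omega>)) \<xi>'"
    and noise_measurable: "\<And>k. E k \<in> borel_measurable P" "\<And>k. E' k \<in> borel_measurable P"
    and accurate: "prob_sufficiently_accurate P (history P G E E') G X grad\<phi> \<theta> \<delta>"
    and constant_step_nondegenerate: "\<tau> = 1 \<Longrightarrow> \<epsilon> < \<phi> x0 - \<phi> xstar \<Longrightarrow>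
      2 \<le> 2 * (1 - \<delta>) / ((1 - 2 * \<delta>)\<^sup>2 - \<gamma>) * (2 * log (1 / M) ((\<phi> x0 - \<phi> xstar) / \<epsilon>))"
  shows "(\<integral>\<^sup>+ \<omega>. ennreal_of_enat (stopping_index \<phi> (\<phi> xstar) \<epsilon> X \<omega>) \<partial>P)
    \<le> ennreal (2 * (1 - \<delta>) / ((1 - 2 * \<delta>)\<^sup>2 - \<gamma>) *
        (2 * log (1 / M) ((\<phi> x0 - \<phi> xstar) / \<epsilon>) + (1 - \<gamma>) * log \<tau> (\<alpha>bar / \<alpha>0)))"
proof (cases "\<epsilon> < \<phi> x0 - \<phi> xstar")
  case False
  interpret prob_space P by (rule P)
  \<comment> \<open>The accuracy holds at the start, so the expectation is 0, which is below every
    \<open>ennreal\<close>, whatever the sign of the real bound.\<close>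
  have "stopping_index \<phi> (\<phi> xstar) \<epsilon> X \<omega> = 0" if "\<omega> \<in> space P" for \<omega>
    using less_stopping_index_iff[of 0 \<phi> "\<phi> xstar" \<epsilon> X \<omega>] run[OF that] False
    by (simp add: line_search_run_def zero_enat_def[symmetric])
  then have "(\<integral>\<^sup>+ \<omega>. ennreal_of_enat (stopping_index \<phi> (\<phi> xstar) \<epsilon> X \<omega>) \<partial>P) = (\<integral>\<^sup>+ \<omega>. 0 \<partial>P)"
    by (intro nn_integral_cong) simp
  then show ?thesis by simp
next
  case True
  interpret prob_space P by (rule P)
  interpret noisy_line_search \<phi> grad\<phi> f L \<mu> \<epsilon>f \<epsilon> \<gamma> \<theta> c1 \<alpha>bar M xstar
    by unfold_locales (fact assms)+
  define N where "N = stopping_index \<phi> (\<phi> xstar) \<epsilon> X"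
  define F where "F = history P G E E'"
  define T where "T k = {\<omega> \<in> space P. accurate_grad (X k \<omega>) (G k \<omega>)}" for k
  define q where "q = 1 - 2 * \<delta>"
  define z where "z = log_gap x0"
  have x0: "\<epsilon> < gap x0" using True by (simp add: gap_def)
  have z: "0 \<le> z" unfolding z_def by (rule log_gap_nonneg[OF x0])
  have sub: "subalgebra P (F k)" for k
    unfolding F_def by (intro history_subalgebra G_measurable noise_measurable)
  have "continuous_on UNIV \<phi>"
    using gradient unfolding gderiv_def
    by (auto intro!: continuous_at_imp_continuous_on has_derivative_continuous)
  then have \<phi> [measurable]: "\<phi> \<in> borel_measurable borel"
    by (rule borel_measurable_continuous_onI)
  have grad\<phi> [measurable]: "grad\<phi> \<in> borel_measurable borel"
    by (rule borel_measurable_continuous_onI[OF C1])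
  have XF: "X j \<in> borel_measurable (F k)" if "j \<le> k" for j k
    using line_search_history_measurable[OF \<phi> run E_def E'_def, where k = j] history_mono[OF that, of P G E E']
    by (auto simp: measurable_def F_def)
  \<comment> \<open>Whether \<open>k < N\<close> is decided by the iterates up to
    \<open>X k\<close>, hence before \<open>G k\<close> is drawn.\<close>
  have N_sets: "{\<omega> \<in> space P. enat k < N \<omega>} \<in> sets (F k)" for k
  proof -
    have "{\<omega> \<in> space (F k). \<epsilon> < \<phi> (X i \<omega>) - \<phi> xstar} \<in> sets (F k)" if "i \<le> k" for i
    proof -
      note [measurable] = XF[OF that]
      show ?thesis by measurable
    qed
    then have "(\<Inter>i\<in>{..k}. {\<omega> \<in> space (F k). \<epsilon> < \<phi> (X i \<omega>) - \<phi> xstar}) \<in> sets (F k)"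
      by (intro sets.finite_INT) auto
    also have "(\<Inter>i\<in>{..k}. {\<omega> \<in> space (F k). \<epsilon> < \<phi> (X i \<omega>) - \<phi> xstar})
        = {\<omega> \<in> space P. enat k < N \<omega>}"
      by (auto simp: N_def less_stopping_index_iff F_def)
    finally show ?thesis .
  qed
  have T_sets: "T k \<in> sets P" for k
  proof -
    have [measurable]: "X k \<in> borel_measurable P" "G k \<in> borel_measurable P"
      using measurable_from_subalg[OF sub XF[OF order_refl]] G_measurable by auto
    show ?thesis unfolding T_def accurate_grad_def by measurable
  qed
  have cond: "AE \<omega> in P. 1 - \<delta> \<le> real_cond_exp P (F k) (indicator (T k)) \<omega>" for k
    using accurate by (simp add: prob_sufficiently_accurate_def T_def accurate_grad_def F_def)
  \<comment> \<open>Testing the accuracy condition on the whole space gives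
    \<open>0 \<le> \<delta>\<close>, that is \<open>q \<le> 1\<close>, as the drift comparison
    requires.\<close>
  have "(1 - \<delta>) * prob (space P) \<le> prob (T 0 \<inter> space P)"
    using cond_exp_indicator_ge[OF sub T_sets _ cond, of "space P"] sets.top[of "F 0"]
    by (simp add: F_def)
  also have "\<dots> \<le> 1" by (rule prob_le_1)
  finally have "0 \<le> \<delta>" by (simp add: prob_space)
  then have q: "sqrt \<gamma> < q" "q \<le> 1" using \<delta> by (auto simp: q_def)
  note rate = drift_comparison[OF \<gamma> q]
  have p: "1 - \<delta> = (1 + q) / 2" and q1: "1 + q = 2 * (1 - \<delta>)" by (simp_all add: q_def)
  have gaps: "\<epsilon> < gap (X i \<omega>)" if "enat n \<le> N \<omega>" "i < n" for n i \<omega>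
    using less_stopping_index_iff[of i \<phi> "\<phi> xstar" \<epsilon> X \<omega>] that
    by (metis N_def enat_ord_simps(2) gap_def le_refl less_le_trans)
  have ind: "indicator (T i) \<omega> = (of_bool (accurate_grad (X i \<omega>) (G i \<omega>)) :: real)"
    if "\<omega> \<in> space P" for i \<omega>
    using that by (simp add: T_def indicator_def)
  obtain c :: nat where c: "0 < c" "\<alpha>bar = \<tau> ^ c * \<alpha>0" using step_size_convention by blast
  show ?thesis
  proof (cases "\<tau> = 1")
    case False
    then have "log \<tau> (\<alpha>bar / \<alpha>0) = c" using \<tau> \<alpha>0_pos c by simp
    have "(\<integral>\<^sup>+ \<omega>. ennreal_of_enat (N \<omega>) \<partial>P)
        \<le> ennreal ((z + (1 - \<gamma>) / 2 * (c + 1)) / (1 - \<delta> - (1 + \<gamma>) / 2))"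
    proof (rule expected_stopping_time_le[OF sub N_sets T_sets cond])
      fix n \<omega> assume \<omega>: "\<omega> \<in> space P" "enat n \<le> N \<omega>"
      show "(\<Sum>i<n. indicator (T i) \<omega>) \<le> z + (1 - \<gamma>) / 2 * (c + 1) + (1 + \<gamma>) / 2 * n"
        using accurate_count[OF run[OF \<omega>(1)] \<tau>(1) \<alpha>0_pos gaps[OF \<omega>(2)] x0 \<tau>(2) c(2)] \<omega>
        by (simp add: ind z_def)
    qed (use rate p in simp)
    also have "\<dots> \<le> ennreal ((1 + q) / (q\<^sup>2 - \<gamma>) * (2 * z + (1 - \<gamma>) * c))"
    proof (rule ennreal_leI)
      have "(z + (1 - \<gamma>) / 2 * (c + 1)) / (1 - \<delta> - (1 + \<gamma>) / 2)
          = (2 * z + (1 - \<gamma>) * (c + 1)) / (q - \<gamma>)"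
        using rate by (simp add: p divide_simps) (simp add: algebra_simps)
      also have "\<dots> \<le> (2 * (2 * z + (1 - \<gamma>) * c)) / (q - \<gamma>)"
      proof (rule divide_right_mono)
        \<comment> \<open>Since \<open>c\<close> is positive, doubling the bracket pays for the
          overshoot; the factor 2 is then absorbed by the drift comparison.\<close>
        have "(1 - \<gamma>) * (c + 1) \<le> (1 - \<gamma>) * (2 * c)"
          using \<gamma> c by (intro mult_left_mono) auto
        then show "2 * z + (1 - \<gamma>) * (c + 1) \<le> 2 * (2 * z + (1 - \<gamma>) * c)"
          using z by (simp add: algebra_simps)
      qed (use rate in simp)
      also have "\<dots> = 2 / (q - \<gamma>) * (2 * z + (1 - \<gamma>) * c)" by simp
      also have "\<dots> \<le> (1 + q) / (q\<^sup>2 - \<gamma>) * (2 * z + (1 - \<gamma>) * c)"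
        using rate z \<gamma> by (intro mult_right_mono) (auto simp: frac_le_eq divide_simps mult.commute)
      finally show "(z + (1 - \<gamma>) / 2 * (c + 1)) / (1 - \<delta> - (1 + \<gamma>) / 2)
        \<le> (1 + q) / (q\<^sup>2 - \<gamma>) * (2 * z + (1 - \<gamma>) * c)" .
    qed
    finally show ?thesis
      unfolding q1 \<open>log \<tau> (\<alpha>bar / \<alpha>0) = c\<close> unfolding N_def z_def log_gap_def gap_def q_def .
  next
    case True
    define R where "R = (1 + q) / (q\<^sup>2 - \<gamma>) * (2 * z)"
    \<comment> \<open>For \<open>\<tau> = 1\<close> the step size term vanishes, and
      \<open>2 \<le> R\<close> takes over the role of \<open>1 \<le> c\<close> in paying for the
      last iteration.\<close>
    have R: "2 \<le> R"
      using constant_step_nondegenerate[OF True \<open>\<epsilon> < \<phi> x0 - \<phi> xstar\<close>]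
      unfolding R_def q1 unfolding z_def log_gap_def gap_def q_def .
    have "(\<integral>\<^sup>+ \<omega>. ennreal_of_enat (N \<omega>) \<partial>P) \<le> ennreal ((z + (1 - \<gamma>)) / (1 - \<delta> - \<gamma>))"
    proof (rule expected_stopping_time_le[OF sub N_sets T_sets cond])
      fix n \<omega> assume \<omega>: "\<omega> \<in> space P" "enat n \<le> N \<omega>"
      show "(\<Sum>i<n. indicator (T i) \<omega>) \<le> z + (1 - \<gamma>) + \<gamma> * n"
        using accurate_count_constant_step[OF run[OF \<omega>(1)] \<tau>(1) \<alpha>0_pos gaps[OF \<omega>(2)] x0 True]
          c True \<omega> by (simp add: ind z_def)
    qed (use rate p \<gamma> in simp)
    also have "\<dots> \<le> ennreal R"
    proof (rule ennreal_leI)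
      have "0 < q" using rate \<gamma> by linarith
      \<comment> \<open>Here \<open>b\<close> is the claimed drift, so \<open>R * b = z\<close>. It
        remains to cover \<open>1 - \<gamma>\<close> by \<open>R\<close> times the surplus drift,
        which is at least \<open>(1 - \<gamma>) / 2\<close>.\<close>
      define b where "b = (q\<^sup>2 - \<gamma>) / (2 * (1 + q))"
      have "R * b = z" using rate \<open>0 < q\<close> by (simp add: R_def b_def divide_simps)
      have "q\<^sup>2 - \<gamma> \<le> 2 * (q\<^sup>2 - \<gamma>)" using rate(1) by simp
      also have "\<dots> \<le> (1 + q) * (q - \<gamma>)" by (rule rate(3))
      also have "\<dots> = (q - \<gamma>) / 2 * (2 * (1 + q))" by simp
      finally have "b \<le> (q - \<gamma>) / 2"
        unfolding b_def using \<open>0 < q\<close> by (subst pos_divide_le_eq) auto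
      then have "2 * ((1 - \<gamma>) / 2) \<le> R * (1 - \<delta> - \<gamma> - b)"
        using R \<gamma> p by (intro mult_mono) auto
      then have "1 - \<gamma> \<le> R * (1 - \<delta> - \<gamma> - b)" by simp
      then have "z + (1 - \<gamma>) \<le> R * (1 - \<delta> - \<gamma>)"
        using \<open>R * b = z\<close> by (simp add: algebra_simps)
      then show "(z + (1 - \<gamma>)) / (1 - \<delta> - \<gamma>) \<le> R"
        using rate \<gamma> by (subst pos_divide_le_eq) (simp_all add: p)
    qed
    \<comment> \<open>As \<open>ln 1 = 0\<close> and division by zero yields 0, \<open>log 1\<close>
      is constantly 0, in line with the convention for the constant step size.\<close>
    finally show ?thesis
      unfolding R_def q1 unfolding N_def z_def log_gap_def gap_def q_def
      by (simp add: True log_def[of 1])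
  qed
qed

end
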